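(* Let $f$ be a circuit function with support $A=A^+\cup\{\beta\}\subset\mathbb{R}^n$ which lies in the DSONC cone $D_{A^+,\beta}$. Let $T:\mathbb{R}^n\to\mathbb{R}^n$, $T(x)=Mx+a$, be an affine transformation with $M\in\mathrm{GL}(n,\mathbb{R})$ and $a\in\mathbb{R}^n$. Then the exponential sum $x\mapsto f(T(x))$, which is supported on $\{M^\top\alpha:\alpha\in A^+\}\cup\{M^\top\beta\}$, is also contained in the DSONC cone, i.e. $f\circ T\in D_{M^\top A^+,\,M^\top\beta}$.
   Context: A (simplicial) circuit with inner point is a set $A=A^+\cup\{\beta\}\subset\mathbb{R}^n$ where $A^+$ is a finite affinely independent set with at least two points and $\beta$ is in the relative interior of the simplex $\mathrm{conv}(A^+)$. A circuit function with support $A=A^+\cup\{\beta\}$ is an exponential sum $f(x)=\sum_{\alpha\in A^+}c_\alpha e^{\langle x,\alpha\rangle}+c_\beta e^{\langle x,\beta\rangle}$ with $c_\alpha>0$ for all $\alpha\in A^+$ and $c_\beta\in\mathbb{R}\setminus\{0\}$. DSONC cone: for $A^+\subset\mathbb{R}^n$ finite and $\beta\in\mathrm{conv}(A^+)\setminus A^+$ let $\Lambda(A^+,\beta)=\{\lambda\in\mathbb{R}_{\ge0}^{A^+}:\sum_{\alpha\in A^+}\lambda_\alpha\alpha=\beta,\ \sum_{\alpha\in A^+}\lambda_\alpha=1\}$. Then $D_{A^+,\beta}$ is the set of all exponential sums $\sum_{\alpha\in A^+}c_\alpha e^{\langle x,\alpha\rangle}+c_\beta e^{\langle x,\beta\rangle}$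 with $c_\alpha\ge0$ for all $\alpha\in A^+$ and such that either $c_\beta\ge0$, or $|c_\beta|\le\prod_{\alpha\in A^+}c_\alpha^{\lambda_\alpha}$ for all $\lambda\in\Lambda(A^+,\beta)$ (convention $0^0=1$). Write $M^\top A^+=\{M^\top\alpha:\alpha\in A^+\}$. *)

theory Defs
  imports "HOL-Analysis.Analysis"
begin

definition exp_sum :: "(real^'n) set \<Rightarrow> (real^'n \<Rightarrow> real) \<Rightarrow> real^'n \<Rightarrow> real" where
  "exp_sum S c = (\<lambda>x. \<Sum>\<alpha>\<in>S. c \<alpha> * exp (x \<bullet> \<alpha>))"

(* All coefficients are required to be nonzero, so S is the exact support of f. *)
definition exp_sum_with_support :: "(real^'n) set \<Rightarrow> (real^'n \<Rightarrow> real) \<Rightarrow> bool" where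
  "exp_sum_with_support S f \<longleftrightarrow>
     finite S \<and> (\<exists>c. (\<forall>\<alpha>\<in>S. c \<alpha> \<noteq> 0) \<and> f = exp_sum S c)"

(* The first argument is the set A^+ of outer points; the circuit itself is insert \<beta> A. *)
definition circuit :: "(real^'n) set \<Rightarrow> real^'n \<Rightarrow> bool" where
  "circuit A \<beta> \<longleftrightarrow>
     finite A \<and> \<not> affine_dependent A \<and> 2 \<le> card A \<and> \<beta> \<in> rel_interior (convex hull A)"

(* In a circuit the inner point \<beta> is not in A, so one coefficient family on insert \<beta> A
   encodes the coefficients on A together with the inner coefficient c \<beta>. *)
definition circuit_function ::
    "(real^'n) set \<Rightarrow> real^'n \<Rightarrow> (real^'n \<Rightarrow> real) \<Rightarrow> bool" where
  "circuit_function A \<beta> f \<longleftrightarrow> circuit A \<beta> \<and>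
     (\<exists>c. (\<forall>\<alpha>\<in>A. 0 < c \<alpha>) \<and> c \<beta> \<noteq> 0 \<and> f = exp_sum (insert \<beta> A) c)"

(* The pairs (A, \<beta>) for which the cone below is a meaningful notion. *)
definition dsonc_pair :: "(real^'n) set \<Rightarrow> real^'n \<Rightarrow> bool" where
  "dsonc_pair A \<beta> \<longleftrightarrow> finite A \<and> \<beta> \<in> convex hull A - A"

definition Lambda :: "(real^'n) set \<Rightarrow> real^'n \<Rightarrow> (real^'n \<Rightarrow> real) set" where
  "Lambda A \<beta> =
     {l \<in> A \<rightarrow>\<^sub>E {0..}. (\<Sum>\<alpha>\<in>A. l \<alpha> *\<^sub>R \<alpha>) = \<beta> \<and> (\<Sum>\<alpha>\<in>A. l \<alpha>) = 1}"

(* The power of nonnegative reals with the convention 0^0 = 1, whereas 0 powr 0 = 0. *)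
definition rpow :: "real \<Rightarrow> real \<Rightarrow> real" where
  "rpow x a = (if a = 0 then 1 else x powr a)"

(* As for circuit functions, one coefficient family is used on insert \<beta> A;
   this relies on \<beta> \<notin> A, which is part of dsonc_pair. *)
definition dsonc_cone :: "(real^'n) set \<Rightarrow> real^'n \<Rightarrow> (real^'n \<Rightarrow> real) set" where
  "dsonc_cone A \<beta> =
     {f. \<exists>c. f = exp_sum (insert \<beta> A) c \<and> (\<forall>\<alpha>\<in>A. 0 \<le> c \<alpha>) \<and>
          (0 \<le> c \<beta> \<or> (\<forall>l\<in>Lambda A \<beta>. \<bar>c \<beta>\<bar> \<le> (\<Prod>\<alpha>\<in>A. rpow (c \<alpha>) (l \<alpha>))))}"

end

theory Submission
  imports Defs
begin

text \<open>
  Since \<open>\<langle>Mx + a, \<alpha>\<rangle> = \<langle>x, M\<^sup>T\<alpha>\<rangle> + \<langle>a, \<alpha>\<rangle>\<close>, the substitution moves each exponent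
  \<open>\<alpha>\<close> to \<open>M\<^sup>T\<alpha>\<close> and scales its coefficient by \<open>e\<^bsup>\<langle>a, \<alpha>\<rangle>\<^esup>\<close>.  The map \<open>M\<^sup>T\<close>
  identifies the barycentric weights of \<open>\<beta>\<close> with those of \<open>M\<^sup>T\<beta>\<close>, and for such weights
  \<open>\<lambda>\<close> the product of the factors \<open>e\<^bsup>\<lambda>\<^sub>\<alpha>\<langle>a, \<alpha>\<rangle>\<^esup>\<close> is exactly \<open>e\<^bsup>\<langle>a, \<beta>\<rangle>\<^esup>\<close>, so both
  sides of the circuit inequality are scaled by the same factor.
\<close>

text \<open>As a simp rule this would turn \<open>transpose M *v x\<close> into
  \<open>x v* M\<close> and hide the map applied to the exponents.\<close>

declare transpose_matrix_vector [simp del]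

text \<open>Affinely independent points are extreme in their convex hull, and an extreme point of a
  convex set with more than one point is not in its relative interior.\<close>

lemma circuit_imp_dsonc_pair:
  assumes "circuit A \<beta>"
  shows "dsonc_pair A \<beta>"
proof -
  have fin: "finite A" and indep: "\<not> affine_dependent A" and card: "2 \<le> card A"
    and \<beta>: "\<beta> \<in> rel_interior (convex hull A)"
    using assms by (auto simp: circuit_def)
  have "\<beta> \<notin> A"
  proof
    assume "\<beta> \<in> A"
    then have "\<beta> extreme_point_of convex hull A"
      using extreme_point_of_convex_hull_affine_independent[OF indep] by blast
    \<comment> \<open>A single point is its own relative interior; having two outer points rules
      this case out.\<close>
    moreover have "convex hull A \<noteq> {\<beta>}"
    proof
      assume "convex hull A = {\<beta>}"
      then have "A \<subseteq> {\<beta>}"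
        using hull_subset[of A convex] by simp
      then have "card A \<le> 1"
        using card_mono[of "{\<beta>}" A] by simp
      with card show False by simp
    qed
    ultimately show False
      using \<beta> extreme_point_not_in_REL_INTERIOR by blast
  qed
  moreover have "\<beta> \<in> convex hull A"
    using \<beta> rel_interior_subset by blast
  ultimately show ?thesis
    using fin by (simp add: dsonc_pair_def)
qed

lemma dsonc_pair_linear_image:
  assumes "dsonc_pair A \<beta>" "linear L" "inj L"
  shows "dsonc_pair (L ` A) (L \<beta>)"
  using assms by (auto simp: dsonc_pair_def convex_hull_linear_image[symmetric] inj_image_mem_iff)

text \<open>Injectivity keeps distinct exponents distinct, so the sum can be reindexed term by
  term.\<close>

lemma exp_sum_comp_affine:
  fixes M :: "real^'n^'n" and a :: "real^'n"
  assumes inj: "inj ((*v) (transpose M))"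
    and d: "\<And>\<alpha>. d (transpose M *v \<alpha>) = c \<alpha> * exp (a \<bullet> \<alpha>)"
  shows "exp_sum S c \<circ> (\<lambda>x. M *v x + a) = exp_sum ((*v) (transpose M) ` S) d"
proof -
  have "inj_on ((*v) (transpose M)) S"
    using inj by (rule inj_on_subset) simp
  moreover have "(M *v x) \<bullet> \<alpha> = x \<bullet> (transpose M *v \<alpha>)" for x \<alpha>
    by (metis dot_lmul_matrix inner_commute transpose_matrix_vector)
  ultimately show ?thesis
    by (simp add: exp_sum_def fun_eq_iff sum.reindex d inner_add_left exp_add mult_ac)
qed

text \<open>An injective linear map cancels from the barycentric equation. \<open>restrict\<close>
  is there because members of \<open>Lambda\<close> are extensional.\<close>

lemma Lambda_pullback:
  assumes "linear L" "inj L" "l \<in> Lambda (L ` A) (L \<beta>)"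
  shows "restrict (l \<circ> L) A \<in> Lambda A \<beta>"
proof -
  have inj: "inj_on L A"
    using \<open>inj L\<close> by (rule inj_on_subset) simp
  have nn: "\<And>\<alpha>. \<alpha> \<in> A \<Longrightarrow> 0 \<le> l (L \<alpha>)"
    and bary: "(\<Sum>\<alpha>\<in>A. l (L \<alpha>) *\<^sub>R L \<alpha>) = L \<beta>" and one: "(\<Sum>\<alpha>\<in>A. l (L \<alpha>)) = 1"
    using assms(3) by (auto simp: Lambda_def sum.reindex[OF inj] PiE_iff)
  have "L (\<Sum>\<alpha>\<in>A. l (L \<alpha>) *\<^sub>R \<alpha>) = L \<beta>"
    using bary by (simp add: linear_sum[OF \<open>linear L\<close>] linear_scale[OF \<open>linear L\<close>])
  then have "(\<Sum>\<alpha>\<in>A. l (L \<alpha>) *\<^sub>R \<alpha>) = \<beta>"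
    using \<open>inj L\<close> by (simp add: inj_eq)
  then show ?thesis
    using nn one by (auto simp: Lambda_def)
qed

lemma rpow_mult_exp:
  assumes "0 \<le> x"
  shows "rpow (x * exp t) s = rpow x s * exp (s * t)"
  using assms by (simp add: rpow_def powr_mult exp_powr_real mult.commute)

lemma prod_rpow_mult_exp_inner:
  assumes "finite A" "l \<in> Lambda A \<beta>" "\<And>\<alpha>. \<alpha> \<in> A \<Longrightarrow> 0 \<le> c \<alpha>"
  shows "(\<Prod>\<alpha>\<in>A. rpow (c \<alpha> * exp (a \<bullet> \<alpha>)) (l \<alpha>)) = (\<Prod>\<alpha>\<in>A. rpow (c \<alpha>) (l \<alpha>)) * exp (a \<bullet> \<beta>)"
proof -
  have "\<beta> = (\<Sum>\<alpha>\<in>A. l \<alpha> *\<^sub>R \<alpha>)"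
    using assms(2) by (simp add: Lambda_def)
  then have "a \<bullet> \<beta> = (\<Sum>\<alpha>\<in>A. l \<alpha> * (a \<bullet> \<alpha>))"
    by (simp add: inner_sum_right)
  then show ?thesis
    using assms(1,3) by (simp add: exp_sum rpow_mult_exp prod.distrib)
qed

lemma dsonc_cone_comp_affine:
  fixes M :: "real^'n^'n" and a :: "real^'n"
  assumes "finite A" "f \<in> dsonc_cone A \<beta>" and inj: "inj ((*v) (transpose M))"
  shows "f \<circ> (\<lambda>x. M *v x + a) \<in> dsonc_cone ((*v) (transpose M) ` A) (transpose M *v \<beta>)"
proof -
  let ?L = "(*v) (transpose M)"
  obtain c where f: "f = exp_sum (insert \<beta> A) c" and c: "\<And>\<alpha>. \<alpha> \<in> A \<Longrightarrow> 0 \<le> c \<alpha>"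
    and c\<beta>: "0 \<le> c \<beta> \<or> (\<forall>l\<in>Lambda A \<beta>. \<bar>c \<beta>\<bar> \<le> (\<Prod>\<alpha>\<in>A. rpow (c \<alpha>) (l \<alpha>)))"
    using assms(2) by (auto simp: dsonc_cone_def)
  \<comment> \<open>The scaled coefficients, reindexed by the new exponents.\<close>
  define d where "d = (\<lambda>\<gamma>. c (inv ?L \<gamma>) * exp (a \<bullet> inv ?L \<gamma>))"
  have d: "d (?L \<alpha>) = c \<alpha> * exp (a \<bullet> \<alpha>)" for \<alpha>
    by (simp add: d_def inv_f_f[OF inj])
  have injA: "inj_on ?L A"
    using inj by (rule inj_on_subset) simp
  have "\<bar>d (?L \<beta>)\<bar> \<le> (\<Prod>\<gamma>\<in>?L ` A. rpow (d \<gamma>) (l \<gamma>))"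
    if neg: "\<not> 0 \<le> d (?L \<beta>)" and l: "l \<in> Lambda (?L ` A) (?L \<beta>)" for l
  proof -
    define k where "k = restrict (l \<circ> ?L) A"
    have k: "k \<in> Lambda A \<beta>"
      unfolding k_def using Lambda_pullback[OF matrix_vector_mul_linear inj l] .
    \<comment> \<open>The positive factor \<open>exp (a \<bullet> \<beta>)\<close> preserves the
      sign, so the product bound must hold for \<open>c\<close>.\<close>
    have "\<not> 0 \<le> c \<beta>"
      using neg by (auto simp: d)
    then have "\<bar>c \<beta>\<bar> * exp (a \<bullet> \<beta>) \<le> (\<Prod>\<alpha>\<in>A. rpow (c \<alpha>) (k \<alpha>)) * exp (a \<bullet> \<beta>)"
      using c\<beta> k by (intro mult_right_mono) auto
    also have "\<dots> = (\<Prod>\<alpha>\<in>A. rpow (c \<alpha> * exp (a \<bullet> \<alpha>)) (k \<alpha>))"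
      using prod_rpow_mult_exp_inner[OF \<open>finite A\<close> k c] by simp
    also have "\<dots> = (\<Prod>\<gamma>\<in>?L ` A. rpow (d \<gamma>) (l \<gamma>))"
      by (simp add: prod.reindex[OF injA] d k_def)
    finally show ?thesis
      by (simp add: d abs_mult)
  qed
  moreover have "f \<circ> (\<lambda>x. M *v x + a) = exp_sum (insert (?L \<beta>) (?L ` A)) d"
    unfolding f using exp_sum_comp_affine[of M d c a, OF inj d] by simp
  ultimately show ?thesis
    using c by (auto simp: dsonc_cone_def d intro!: exI[of _ d])
qed

text \<open>Exponential factors never vanish, so nonzero coefficients stay nonzero.\<close>

lemma exp_sum_with_support_comp_affine:
  fixes M :: "real^'n^'n" and a :: "real^'n"
  assumes "exp_sum_with_support S f" and inj: "inj ((*v) (transpose M))"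
  shows "exp_sum_with_support ((*v) (transpose M) ` S) (f \<circ> (\<lambda>x. M *v x + a))"
proof -
  let ?L = "(*v) (transpose M)"
  obtain c where "finite S" and c: "\<And>\<alpha>. \<alpha> \<in> S \<Longrightarrow> c \<alpha> \<noteq> 0" and f: "f = exp_sum S c"
    using assms(1) by (auto simp: exp_sum_with_support_def)
  define d where "d = (\<lambda>\<gamma>. c (inv ?L \<gamma>) * exp (a \<bullet> inv ?L \<gamma>))"
  have d: "d (?L \<alpha>) = c \<alpha> * exp (a \<bullet> \<alpha>)" for \<alpha>
    by (simp add: d_def inv_f_f[OF inj])
  show ?thesis
    unfolding exp_sum_with_support_def f exp_sum_comp_affine[of M d c a, OF inj d]
    using \<open>finite S\<close> c d by (auto intro!: exI[of _ d])
qed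

theorem proposition4p15:
  fixes A :: "(real^'n) set" and \<beta> a :: "real^'n"
    and f :: "real^'n \<Rightarrow> real" and M :: "real^'n^'n" and T :: "real^'n \<Rightarrow> real^'n"
  assumes "circuit_function A \<beta> f"
    and "f \<in> dsonc_cone A \<beta>"
    and "invertible M"
    and "T = (\<lambda>x. M *v x + a)"
  shows "exp_sum_with_support
           ({transpose M *v \<alpha> | \<alpha>. \<alpha> \<in> A} \<union> {transpose M *v \<beta>}) (f \<circ> T) \<and>
         dsonc_pair {transpose M *v \<alpha> | \<alpha>. \<alpha> \<in> A} (transpose M *v \<beta>) \<and>
         f \<circ> T \<in> dsonc_cone {transpose M *v \<alpha> | \<alpha>. \<alpha> \<in> A} (transpose M *v \<beta>)"
proof -
  let ?L = "(*v) (transpose M)"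
  have inj: "inj ?L"
    using \<open>invertible M\<close> by (simp add: inj_matrix_vector_mult transpose_invertible)
  have img: "{?L \<alpha> | \<alpha>. \<alpha> \<in> A} = ?L ` A" and ins: "?L ` A \<union> {?L \<beta>} = ?L ` insert \<beta> A"
    by auto
  have circ: "circuit A \<beta>"
    using assms(1) by (simp add: circuit_function_def)
  then have "finite A"
    by (simp add: circuit_def)
  then have supp: "exp_sum_with_support (insert \<beta> A) f"
    using assms(1) by (force simp: circuit_function_def exp_sum_with_support_def)
  show ?thesis
    unfolding img ins assms(4)
    using exp_sum_with_support_comp_affine[OF supp inj]
      dsonc_pair_linear_image[OF circuit_imp_dsonc_pair[OF circ] matrix_vector_mul_linear inj]
      dsonc_cone_comp_affine[OF \<open>finite A\<close> assms(2) inj]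
    by blast
qed

end
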